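(* Let $A$, $\widehat P_0$, and the contraction constant $r<1$ be as in the context. There is $\delta>0$ such that the following holds for every sequence of Newton iterates $\{u_k\}$ as in the context with $\|e_0\|<\delta$. If the correction equation is solved exactly at every step, i.e. $s_k\perp u_k$ and $J_ks_k=-r_k$ for all $k\ge 0$, then for every $k\ge 0$ the matrix $\widehat P_k$ defined by the recursion $$\widehat P_{k+1}=-\frac{s_ks_k^\top}{s_k^\top r_k}+\Big(I-\frac{s_kr_k^\top}{s_k^\top r_k}\Big)\widehat P_k\Big(I-\frac{r_ks_k^\top}{s_k^\top r_k}\Big)$$ is symmetric positive definite, and hence $P_k=(I-u_ku_k^\top)\widehat P_k(I-u_ku_k^\top)$ is symmetric positive definite on the subspace orthogonal to $u_k$.
   Context: $A\in\mathbb{R}^{n\times n}$ is symmetric positive definite with eigenvalues $\lambda_1<\lambda_2<\dots<\lambda_n$ and corresponding unit eigenvectors $v_1,\dots,v_n$. Newton iteration for the smallest eigenpair: $u_0$ is a unit vector; for $k\ge 0$, $\theta_k=u_k^\top A u_k$, $r_k=Au_k-\theta_k u_k$ (residual vector), and $$J_k=(I-u_ku_k^\top)(A-\theta_k I)(I-u_ku_k^\top).$$ The vector $s_k$ is the solution, orthogonal to $u_k$, of the correction equation $J_k s_k=-r_k$, and $u_{k+1}=(u_k+s_k)/\|u_k+s_k\|$. It is assumed that $s_k\neq 0$, so that the recursion for $\widehat P_k$ makes sense. Set $e_k=u_k-v_1$. Standing assumption: convergence holds, i.e. there is a constant $r<1$ with $\|e_{k+1}\|<r\|e_k\|$ for all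 $k\ge0$. The initial preconditioner is $\widehat P_0=(LL^\top)^{-1}$, where $L$ is a nonsingular lower triangular (incomplete Cholesky) factor; thus $\widehat P_0$ is symmetric positive definite. *)

theory Defs
  imports "HOL-Analysis.Analysis"
begin

definition outer_prod :: "real^'n \<Rightarrow> real^'n \<Rightarrow> real^'n^'n" where
  "outer_prod x y = (\<chi> i j. x $ i * y $ j)"

definition sym_pos_def :: "real^'n^'n \<Rightarrow> bool" where
  "sym_pos_def M \<longleftrightarrow> transpose M = M \<and> (\<forall>x. x \<noteq> 0 \<longrightarrow> x \<bullet> (M *v x) > 0)"

text \<open>
  The matrix \<open>M\<close> maps the subspace \<open>S\<close> into itself, and its restriction to \<open>S\<close> is
  self-adjoint and positive definite with respect to the inner product inherited by \<open>S\<close>.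
\<close>
definition sym_pos_def_on :: "(real^'n) set \<Rightarrow> real^'n^'n \<Rightarrow> bool" where
  "sym_pos_def_on S M \<longleftrightarrow>
     (\<forall>x\<in>S. M *v x \<in> S) \<and>
     (\<forall>x\<in>S. \<forall>y\<in>S. (M *v x) \<bullet> y = x \<bullet> (M *v y)) \<and>
     (\<forall>x\<in>S. x \<noteq> 0 \<longrightarrow> x \<bullet> (M *v x) > 0)"

definition lower_triangular :: "real^('n::{finite,linorder})^('n::{finite,linorder}) \<Rightarrow> bool" where
  "lower_triangular L \<longleftrightarrow> (\<forall>i j. i < j \<longrightarrow> L $ i $ j = 0)"

definition rayleigh :: "real^'n^'n \<Rightarrow> real^'n \<Rightarrow> real" where
  "rayleigh A u = u \<bullet> (A *v u)"

definition residual :: "real^'n^'n \<Rightarrow> real^'n \<Rightarrow> real^'n" where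
  "residual A u = A *v u - rayleigh A u *\<^sub>R u"

text \<open>For a unit vector \<open>u\<close> this is the orthogonal projection onto the complement of \<open>u\<close>.\<close>
definition compl_proj :: "real^'n \<Rightarrow> real^'n^'n" where
  "compl_proj u = mat 1 - outer_prod u u"

definition newton_jacobian :: "real^'n^'n \<Rightarrow> real^'n \<Rightarrow> real^'n^'n" where
  "newton_jacobian A u = compl_proj u ** (A - rayleigh A u *\<^sub>R mat 1) ** compl_proj u"

text \<open>
  The corrections \<open>s\<close> are part of the data and are nonzero exact solutions of the correction
  equation. The normalisation never divides by zero, since \<open>u k\<close> is a unit vector
  orthogonal to \<open>s k\<close>.
\<close>
definition newton_iterates ::
    "real^'n^'n \<Rightarrow> (nat \<Rightarrow> real^'n) \<Rightarrow> (nat \<Rightarrow> real^'n) \<Rightarrow> bool" where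
  "newton_iterates A u s \<longleftrightarrow>
     norm (u 0) = 1 \<and>
     (\<forall>k. orthogonal (s k) (u k) \<and>
          newton_jacobian A (u k) *v s k = - residual A (u k) \<and>
          s k \<noteq> 0 \<and>
          u (Suc k) = (u k + s k) /\<^sub>R norm (u k + s k))"

text \<open>
  Meaningful only for \<open>s \<bullet> r \<noteq> 0\<close>: otherwise division by zero makes this return \<open>P\<close>.
\<close>
definition precond_update :: "real^'n \<Rightarrow> real^'n \<Rightarrow> real^'n^'n \<Rightarrow> real^'n^'n" where
  "precond_update s r P =
     - ((1 / (s \<bullet> r)) *\<^sub>R outer_prod s s) +
     (mat 1 - (1 / (s \<bullet> r)) *\<^sub>R outer_prod s r) ** P **
     (mat 1 - (1 / (s \<bullet> r)) *\<^sub>R outer_prod r s)"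

primrec precond ::
    "real^'n^'n \<Rightarrow> (nat \<Rightarrow> real^'n) \<Rightarrow> (nat \<Rightarrow> real^'n) \<Rightarrow> real^'n^'n \<Rightarrow> nat \<Rightarrow> real^'n^'n" where
  "precond A u s P0 0 = P0"
| "precond A u s P0 (Suc k) = precond_update (s k) (residual A (u k)) (precond A u s P0 k)"

end

theory Submission
  imports Defs
begin

text \<open>
  Pairing the correction equation with \<open>s\<close> gives \<open>s \<bullet> r = - (s \<bullet> (A - \<theta> I) s)\<close>, and \<open>A - \<theta> I\<close> is
  positive definite on the complement of \<open>u\<close> once \<open>u\<close> is close to the lowest eigenvector \<open>v 1\<close>: a
  vector orthogonal to \<open>u\<close> has a small component along \<open>v 1\<close>, and the Rayleigh quotient exceeds the
  lowest eigenvalue only by a quadratically small amount, so the spectral gap wins. Hence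
  \<open>s \<bullet> r < 0\<close>, and then the BFGS-type update is a congruence plus a positive multiple of
  \<open>s s\<^sup>T\<close>. It preserves positive definiteness because the congruence is the
  identity on the vectors killed by \<open>s s\<^sup>T\<close>. By contraction all iterates stay
  near \<open>v 1\<close>.
\<close>

lemma outer_prod_mult_vec: "outer_prod x y *v z = (y \<bullet> z) *\<^sub>R x"
  by (simp add: vec_eq_iff outer_prod_def matrix_vector_mult_def inner_vec_def
      sum_distrib_left sum_distrib_right mult_ac)

lemma transpose_outer_prod: "transpose (outer_prod x y) = outer_prod y x"
  by (simp add: vec_eq_iff outer_prod_def transpose_def mult.commute)

lemma transpose_diff: "transpose (M - N) = transpose M - transpose N"
  for M N :: "real^'n^'m"
  by (simp add: vec_eq_iff transpose_def)

lemma inner_mult_vec_transpose: "(M *v x) \<bullet> y = x \<bullet> (transpose M *v y)"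
  for M :: "real^'n^'m"
  by (metis dot_lmul_matrix inner_commute transpose_matrix_vector)

lemma sym_pos_def_inner_commute:
  assumes "sym_pos_def M"
  shows "(M *v x) \<bullet> y = x \<bullet> (M *v y)"
  using assms by (simp add: inner_mult_vec_transpose sym_pos_def_def)

lemma sym_pos_def_inner_ge_0:
  assumes "sym_pos_def M"
  shows "0 \<le> x \<bullet> (M *v x)"
  using assms by (cases "x = 0") (auto simp: sym_pos_def_def intro: less_imp_le)

lemma matrix_inv_right:
  fixes M :: "real^'n^'n"
  assumes "invertible M"
  shows "M ** matrix_inv M = mat 1"
  using assms unfolding invertible_def matrix_inv_def by (rule someI2_ex) blast

lemma sym_pos_def_inverse_gram:
  fixes L :: "real^'n^'n"
  assumes "invertible L"
  shows "sym_pos_def (matrix_inv (L ** transpose L))"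
proof -
  define G where "G = L ** transpose L"
  have invG: "invertible G"
    unfolding G_def using assms by (intro invertible_mult transpose_invertible)
  have symG: "transpose G = G"
    by (simp add: G_def matrix_transpose_mul)
  have inv: "G ** matrix_inv G = mat 1"
    by (rule matrix_inv_right[OF invG])
  have "transpose (matrix_inv G) ** G = mat 1"
    by (metis inv symG matrix_transpose_mul transpose_mat)
  then have "transpose (matrix_inv G) = matrix_inv G"
    by (metis inv matrix_mul_assoc matrix_mul_lid matrix_mul_rid)
  moreover have "0 < x \<bullet> (matrix_inv G *v x)" if "x \<noteq> 0" for x
  proof -
    define y where "y = matrix_inv G *v x"
    have Gy: "G *v y = x"
      by (simp add: y_def matrix_vector_mul_assoc inv)
    then have "transpose L *v y \<noteq> 0"
      using that by (auto simp: G_def simp flip: matrix_vector_mul_assoc)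
    then have "0 < (transpose L *v y) \<bullet> (transpose L *v y)"
      by simp
    also have "\<dots> = y \<bullet> (G *v y)"
      by (simp add: G_def dot_lmul_matrix flip: matrix_vector_mul_assoc)
    finally show ?thesis
      by (simp add: Gy inner_commute flip: y_def)
  qed
  ultimately show ?thesis
    by (simp add: sym_pos_def_def G_def)
qed

lemma sym_pos_def_precond_update:
  assumes P: "sym_pos_def P" and sr: "s \<bullet> r < 0"
  shows "sym_pos_def (precond_update s r P)"
proof -
  define c where "c = 1 / (s \<bullet> r)"
  define M where "M = mat 1 - c *\<^sub>R outer_prod r s"
  have c: "c < 0"
    using sr by (simp add: c_def)
  have MT: "transpose M = mat 1 - c *\<^sub>R outer_prod s r"
    by (simp add: M_def transpose_diff transpose_scalar transpose_outer_prod)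
  have upd: "precond_update s r P = transpose M ** P ** M - c *\<^sub>R outer_prod s s"
    unfolding precond_update_def MT by (simp add: c_def M_def)
  have "transpose (precond_update s r P) = precond_update s r P"
    using P by (simp add: upd transpose_diff transpose_scalar transpose_outer_prod
        matrix_transpose_mul matrix_mul_assoc sym_pos_def_def)
  moreover have "0 < x \<bullet> (precond_update s r P *v x)" if "x \<noteq> 0" for x
  proof -
    have Mx: "M *v x = x - (c * (s \<bullet> x)) *\<^sub>R r"
      by (simp add: M_def matrix_vector_mult_diff_rdistrib scaleR_matrix_vector_assoc[symmetric]
          outer_prod_mult_vec)
    have eq: "x \<bullet> (precond_update s r P *v x) = (- c) * (s \<bullet> x)\<^sup>2 + (M *v x) \<bullet> (P *v (M *v x))"
      by (simp add: upd matrix_vector_mult_diff_rdistrib inner_diff_right inner_mult_vec_transpose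
          outer_prod_mult_vec inner_commute power2_eq_square
          scaleR_matrix_vector_assoc[symmetric]
          del: transpose_matrix_vector flip: matrix_vector_mul_assoc)
    show ?thesis
    proof (cases "s \<bullet> x = 0")
      case True
      then show ?thesis
        using P that by (simp add: eq Mx sym_pos_def_def)
    next
      case False
      then have "0 < (- c) * (s \<bullet> x)\<^sup>2"
        using c by (intro mult_pos_pos) auto
      then show ?thesis
        using sym_pos_def_inner_ge_0[OF P, of "M *v x"] by (simp add: eq)
    qed
  qed
  ultimately show ?thesis
    by (simp add: sym_pos_def_def)
qed

lemma compl_proj_mult_vec: "compl_proj u *v x = x - (u \<bullet> x) *\<^sub>R u"
  by (simp add: compl_proj_def matrix_vector_mult_diff_rdistrib outer_prod_mult_vec)

lemma transpose_compl_proj: "transpose (compl_proj u) = compl_proj u"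
  by (simp add: compl_proj_def transpose_diff transpose_outer_prod)

lemma sym_pos_def_on_compl_proj:
  assumes P: "sym_pos_def P" and u: "norm u = 1"
  shows "sym_pos_def_on (orthogonal_comp {u}) (compl_proj u ** P ** compl_proj u)"
proof -
  have uu: "u \<bullet> u = 1"
    using u by (simp add: norm_eq_1)
  have range: "compl_proj u *v x \<in> orthogonal_comp {u}" for x
    by (simp add: orthogonal_comp_def orthogonal_def compl_proj_mult_vec inner_diff_right
        inner_diff_left uu inner_commute)
  have id: "compl_proj u *v x = x" if "x \<in> orthogonal_comp {u}" for x
    using that by (simp add: orthogonal_comp_def orthogonal_def compl_proj_mult_vec)
  have adj: "x \<bullet> (compl_proj u *v y) = (compl_proj u *v x) \<bullet> y" for x y
    by (simp add: inner_mult_vec_transpose transpose_compl_proj)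
  show ?thesis
    unfolding sym_pos_def_on_def matrix_vector_mul_assoc[symmetric]
  proof (intro conjI ballI impI)
    fix x y assume x: "x \<in> orthogonal_comp {u}" and y: "y \<in> orthogonal_comp {u}"
    show "(compl_proj u *v (P *v (compl_proj u *v x))) \<bullet> y
        = x \<bullet> (compl_proj u *v (P *v (compl_proj u *v y)))"
      unfolding id[OF x] id[OF y]
      by (metis adj id[OF x] id[OF y] inner_commute sym_pos_def_inner_commute[OF P])
  next
    fix x assume "x \<in> orthogonal_comp {u}" "x \<noteq> 0"
    then show "0 < x \<bullet> (compl_proj u *v (P *v (compl_proj u *v x)))"
      using P by (simp add: adj id sym_pos_def_def)
  qed (rule range)
qed

lemma orthonormal_expansion:
  fixes v :: "nat \<Rightarrow> real^'n"
  assumes norm: "\<And>i. i \<in> {1..CARD('n)} \<Longrightarrow> norm (v i) = 1"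
    and orth: "\<And>i j. i \<in> {1..CARD('n)} \<Longrightarrow> j \<in> {1..CARD('n)} \<Longrightarrow> i \<noteq> j \<Longrightarrow> v i \<bullet> v j = 0"
  shows "x = (\<Sum>i\<in>{1..CARD('n)}. (x \<bullet> v i) *\<^sub>R v i)"
proof -
  define I where "I = {1..CARD('n)}"
  have inj: "inj_on v I"
    using norm orth by (intro inj_onI) (metis I_def norm_eq_1 zero_neq_one)
  have ind: "independent (v ` I)"
    using norm orth
    by (intro pairwise_orthogonal_independent)
      (force simp: I_def pairwise_def orthogonal_def)+
  have "card (v ` I) = dim (UNIV :: (real^'n) set)"
    using inj by (simp add: card_image I_def dim_UNIV)
  then have span: "span (v ` I) = UNIV"
    using ind card_ge_dim_independent[of "v ` I" UNIV] by auto
  define y where "y = x - (\<Sum>i\<in>I. (x \<bullet> v i) *\<^sub>R v i)"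
  have "orthogonal y (v j)" if j: "j \<in> I" for j
  proof -
    have "(\<Sum>i\<in>I. (x \<bullet> v i) *\<^sub>R v i) \<bullet> v j = (\<Sum>i\<in>I. if i = j then x \<bullet> v j else 0)"
      unfolding inner_sum_left using j norm[of j] orth[of _ j]
      by (intro sum.cong) (auto simp: I_def norm_eq_1)
    then show ?thesis
      using j by (simp add: y_def orthogonal_def inner_diff_left I_def)
  qed
  then have "orthogonal y y"
    using orthogonal_to_span[of y "v ` I" y] span by auto
  then have "y = 0"
    by (simp add: orthogonal_self)
  then show ?thesis
    by (simp add: y_def I_def)
qed

lemma eigenvectors_orthogonal:
  assumes "sym_pos_def A" and "A *v x = a *\<^sub>R x" and "A *v y = b *\<^sub>R y" and "a \<noteq> b"
  shows "x \<bullet> y = 0"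
  using sym_pos_def_inner_commute[OF assms(1), of x y] assms(2-4) by simp

lemma quadratic_form_gap:
  fixes A :: "real^'n^'n"
  assumes A: "sym_pos_def A"
    and mono: "strict_mono_on {1..CARD('n)} lam"
    and eig: "\<And>i. i \<in> {1..CARD('n)} \<Longrightarrow> A *v v i = lam i *\<^sub>R v i"
    and norm: "\<And>i. i \<in> {1..CARD('n)} \<Longrightarrow> norm (v i) = 1"
  obtains g where "0 < g"
    and "\<And>x. (lam 1 + g) * (x \<bullet> x) - g * (x \<bullet> v 1)\<^sup>2 \<le> x \<bullet> (A *v x)"
proof -
  define I where "I = {1..CARD('n)}"
  have one: "1 \<in> I"
    by (simp add: I_def Suc_leI)
  have orth: "v i \<bullet> v j = 0" if "i \<in> I" "j \<in> I" "i \<noteq> j" for i j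
  proof -
    have "lam i \<noteq> lam j"
      using that strict_mono_on_imp_inj_on[OF mono] by (metis I_def inj_onD)
    then show ?thesis
      using that eigenvectors_orthogonal[OF A eig[of i] eig[of j]] by (simp add: I_def)
  qed
  have expand: "x = (\<Sum>i\<in>I. (x \<bullet> v i) *\<^sub>R v i)" for x
    unfolding I_def by (rule orthonormal_expansion) (use norm orth in \<open>auto simp: I_def\<close>)
  define g where "g = (if 2 \<in> I then lam 2 - lam 1 else 1)"
  have g: "0 < g"
    using mono one by (auto simp: g_def I_def strict_mono_on_def)
  have gap: "lam 1 + g \<le> lam i" if "i \<in> I" "i \<noteq> 1" for i
  proof -
    have "2 \<in> I" "2 \<le> i"
      using that by (auto simp: I_def)
    then have "lam 2 \<le> lam i"
      using strict_mono_on_leD[OF mono, of 2 i] that by (auto simp: I_def)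
    then show ?thesis
      using \<open>2 \<in> I\<close> by (simp add: g_def)
  qed
  have "(lam 1 + g) * (x \<bullet> x) - g * (x \<bullet> v 1)\<^sup>2 \<le> x \<bullet> (A *v x)" for x
  proof -
    have parseval: "y \<bullet> x = (\<Sum>i\<in>I. (x \<bullet> v i) * (y \<bullet> v i))" for y
      by (subst expand[of x]) (simp add: inner_sum_right)
    have "(A *v x) \<bullet> v i = lam i * (x \<bullet> v i)" if "i \<in> I" for i
      using sym_pos_def_inner_commute[OF A, of x "v i"] eig[of i] that by (simp add: I_def)
    then have quad: "x \<bullet> (A *v x) = (\<Sum>i\<in>I. lam i * (x \<bullet> v i)\<^sup>2)"
      using parseval[of "A *v x"] by (simp add: inner_commute[of x "A *v x"] power2_eq_square mult_ac)
    have "- g * (x \<bullet> v 1)\<^sup>2 = (\<Sum>i\<in>I. if i = 1 then - g * (x \<bullet> v 1)\<^sup>2 else 0)"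
      using one by (simp add: I_def)
    also have "\<dots> \<le> (\<Sum>i\<in>I. (lam i - (lam 1 + g)) * (x \<bullet> v i)\<^sup>2)"
      using gap by (intro sum_mono) auto
    also have "\<dots> = x \<bullet> (A *v x) - (lam 1 + g) * (x \<bullet> x)"
      using parseval[of x]
      by (simp add: quad left_diff_distrib sum_subtractf sum_distrib_left power2_eq_square)
    finally show ?thesis
      by simp
  qed
  with g show ?thesis
    by (rule that)
qed

lemma rayleigh_near_eigenvector:
  assumes A: "sym_pos_def A" and w: "A *v w = a *\<^sub>R w" "norm w = 1" and u: "norm u = 1"
  shows "rayleigh A u = a + ((u - w) \<bullet> (A *v (u - w)) - a * (norm (u - w))\<^sup>2)"
proof -
  have "w \<bullet> (A *v u) = a * (w \<bullet> u)"
    using sym_pos_def_inner_commute[OF A, of w u] w by simp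
  moreover have "w \<bullet> w = 1" "u \<bullet> u = 1"
    using w u by (simp_all add: norm_eq_1)
  ultimately show ?thesis
    by (simp add: rayleigh_def power2_norm_eq_inner matrix_vector_mult_diff_distrib inner_diff_left
        inner_diff_right w inner_commute algebra_simps)
qed

lemma shifted_pos_def_near_eigenvector:
  fixes A :: "real^'n^'n"
  assumes A: "sym_pos_def A" and w: "A *v w = a *\<^sub>R w" "norm w = 1"
    and g: "0 < g" "\<And>x. (a + g) * (x \<bullet> x) - g * (x \<bullet> w)\<^sup>2 \<le> x \<bullet> (A *v x)"
  obtains d where "0 < d"
    and "\<And>u s. norm u = 1 \<Longrightarrow> norm (u - w) < d \<Longrightarrow> orthogonal s u \<Longrightarrow> s \<noteq> 0
      \<Longrightarrow> rayleigh A u * (s \<bullet> s) < s \<bullet> (A *v s)"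
proof -
  define K where "K = onorm ((*v) A)"
  have K: "0 \<le> K" and K_bound: "norm (A *v x) \<le> K * norm x" for x
    unfolding K_def by (auto intro: onorm_pos_le onorm matrix_vector_mul_bounded_linear)
  have "w \<noteq> 0"
    using w by auto
  then have "0 < w \<bullet> (A *v w)"
    using A unfolding sym_pos_def_def by blast
  then have a: "0 < a"
    using w by (simp add: norm_eq_1)
  define d where "d = sqrt (g / (K + g))"
  have d: "0 < d" "(K + g) * d\<^sup>2 = g"
    using g K by (auto simp: d_def)
  have "rayleigh A u * (s \<bullet> s) < s \<bullet> (A *v s)"
    if u: "norm u = 1" and e: "norm (u - w) < d" and su: "orthogonal s u" and s: "s \<noteq> 0" for u s
  proof -
    define e where "e = norm (u - w)"
    have "(u - w) \<bullet> (A *v (u - w)) \<le> norm (u - w) * (K * norm (u - w))"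
      by (rule order_trans[OF norm_cauchy_schwarz mult_left_mono[OF K_bound]]) simp
    moreover have "0 \<le> a * e\<^sup>2"
      using a by simp
    ultimately have theta: "rayleigh A u \<le> a + K * e\<^sup>2"
      using rayleigh_near_eigenvector[OF A w u] by (simp add: e_def power2_eq_square mult_ac)
    have "s \<bullet> w = s \<bullet> (w - u)"
      using su by (simp add: inner_diff_right orthogonal_def)
    then have "\<bar>s \<bullet> w\<bar> \<le> norm s * e"
      using Cauchy_Schwarz_ineq2[of s "w - u"] by (simp add: e_def norm_minus_commute)
    then have sw: "(s \<bullet> w)\<^sup>2 \<le> (s \<bullet> s) * e\<^sup>2"
      using power_mono[of "\<bar>s \<bullet> w\<bar>" "norm s * e" 2]
      by (simp add: power_mult_distrib power2_norm_eq_inner)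
    have "e\<^sup>2 < d\<^sup>2"
      using e by (intro power_strict_mono) (auto simp: e_def)
    then have "(K + g) * e\<^sup>2 < g"
      using d g K by (metis add_nonneg_pos mult_strict_left_mono)
    moreover have ss: "0 < s \<bullet> s"
      using s by simp
    ultimately have "(K + g) * e\<^sup>2 * (s \<bullet> s) < g * (s \<bullet> s)"
      by simp
    moreover have "rayleigh A u * (s \<bullet> s) \<le> (a + K * e\<^sup>2) * (s \<bullet> s)"
      using theta ss by (intro mult_right_mono) auto
    moreover have "g * (s \<bullet> w)\<^sup>2 \<le> g * ((s \<bullet> s) * e\<^sup>2)"
      using sw g by (intro mult_left_mono) auto
    ultimately show ?thesis
      using g(2)[of s] by (simp add: algebra_simps)
  qed
  with d(1) show ?thesis
    by (rule that)
qed

lemma inner_residual_correction: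
  assumes su: "orthogonal s u" and eq: "newton_jacobian A u *v s = - residual A u"
  shows "s \<bullet> residual A u = rayleigh A u * (s \<bullet> s) - s \<bullet> (A *v s)"
proof -
  have id: "compl_proj u *v s = s"
    using su by (simp add: compl_proj_mult_vec orthogonal_def inner_commute)
  have "s \<bullet> residual A u = - (s \<bullet> (newton_jacobian A u *v s))"
    by (simp add: eq)
  also have "s \<bullet> (newton_jacobian A u *v s) = s \<bullet> ((A - rayleigh A u *\<^sub>R mat 1) *v s)"
    using inner_mult_vec_transpose[of "compl_proj u" s]
    by (simp add: newton_jacobian_def id transpose_compl_proj flip: matrix_vector_mul_assoc)
  also have "\<dots> = s \<bullet> (A *v s) - rayleigh A u * (s \<bullet> s)"
    by (simp add: matrix_vector_mult_diff_rdistrib inner_diff_right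
        scaleR_matrix_vector_assoc[symmetric])
  finally show ?thesis
    by simp
qed

lemma newton_iterates_norm:
  assumes "newton_iterates A u s"
  shows "norm (u k) = 1"
proof (cases k)
  case 0
  then show ?thesis
    using assms by (simp add: newton_iterates_def)
next
  case (Suc j)
  have "orthogonal (s j) (u j)" "s j \<noteq> 0"
    using assms by (simp_all add: newton_iterates_def)
  then have "s j \<bullet> (u j + s j) \<noteq> 0"
    by (simp add: inner_add_right orthogonal_def)
  then have "u j + s j \<noteq> 0"
    by auto
  then show ?thesis
    using assms by (simp add: newton_iterates_def Suc)
qed

theorem theorem3p2:
  fixes A L P0 :: "real^('n::{finite,linorder})^('n::{finite,linorder})"
    and lam :: "nat \<Rightarrow> real"
    and v :: "nat \<Rightarrow> real^('n::{finite,linorder})"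
    and r :: real
  assumes "sym_pos_def A"
    and "strict_mono_on {1..CARD('n)} lam"
    and "\<And>i. i \<in> {1..CARD('n)} \<Longrightarrow> A *v v i = lam i *\<^sub>R v i"
    and "\<And>i. i \<in> {1..CARD('n)} \<Longrightarrow> norm (v i) = 1"
    and "lower_triangular L"
    and "invertible L"
    and "P0 = matrix_inv (L ** transpose L)"
    and "r < 1"
  shows "\<exists>\<delta>>0. \<forall>u s.
           newton_iterates A u s \<and>
           (\<forall>k. norm (u (Suc k) - v 1) < r * norm (u k - v 1)) \<and>
           norm (u 0 - v 1) < \<delta> \<longrightarrow>
           (\<forall>k. s k \<bullet> residual A (u k) \<noteq> 0 \<and>
                sym_pos_def (precond A u s P0 k) \<and>
                sym_pos_def_on (orthogonal_comp {u k})
                  (compl_proj (u k) ** precond A u s P0 k ** compl_proj (u k)))"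
proof -
  have one: "1 \<in> {1..CARD('n)}"
    by (simp add: Suc_leI)
  obtain g where g: "0 < g"
    "\<And>x. (lam 1 + g) * (x \<bullet> x) - g * (x \<bullet> v 1)\<^sup>2 \<le> x \<bullet> (A *v x)"
    using quadratic_form_gap[OF assms(1-4)] by metis
  obtain d where d: "0 < d"
    and pos: "\<And>u s. norm u = 1 \<Longrightarrow> norm (u - v 1) < d \<Longrightarrow> orthogonal s u \<Longrightarrow> s \<noteq> 0
      \<Longrightarrow> rayleigh A u * (s \<bullet> s) < s \<bullet> (A *v s)"
    using shifted_pos_def_near_eigenvector[OF assms(1) assms(3)[OF one] assms(4)[OF one] g] by metis
  show ?thesis
  proof (intro exI[of _ d] conjI d allI impI)
    fix u s k
    assume "newton_iterates A u s \<and>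
      (\<forall>k. norm (u (Suc k) - v 1) < r * norm (u k - v 1)) \<and> norm (u 0 - v 1) < d"
    then have newton: "newton_iterates A u s"
      and contr: "\<And>k. norm (u (Suc k) - v 1) < r * norm (u k - v 1)"
      and start: "norm (u 0 - v 1) < d"
      by auto
    have near: "norm (u j - v 1) < d" for j
    proof (induction j)
      case (Suc j)
      have "r * norm (u j - v 1) \<le> 1 * norm (u j - v 1)"
        using \<open>r < 1\<close> by (intro mult_right_mono) auto
      then show ?case
        using contr[of j] Suc by linarith
    qed (rule start)
    have neg: "s j \<bullet> residual A (u j) < 0" for j
    proof -
      have "orthogonal (s j) (u j)" "s j \<noteq> 0"
        "newton_jacobian A (u j) *v s j = - residual A (u j)"
        using newton by (simp_all add: newton_iterates_def)
      then show ?thesis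
        using pos[OF newton_iterates_norm[OF newton] near] inner_residual_correction by fastforce
    qed
    have spd: "sym_pos_def (precond A u s P0 j)" for j
    proof (induction j)
      case 0
      then show ?case
        using sym_pos_def_inverse_gram[OF assms(6)] assms(7) by simp
    next
      case (Suc j)
      then show ?case
        by (simp add: sym_pos_def_precond_update neg)
    qed
    show "s k \<bullet> residual A (u k) \<noteq> 0"
      using neg[of k] by simp
    show "sym_pos_def (precond A u s P0 k)"
      by (rule spd)
    show "sym_pos_def_on (orthogonal_comp {u k})
        (compl_proj (u k) ** precond A u s P0 k ** compl_proj (u k))"
      by (intro sym_pos_def_on_compl_proj spd newton_iterates_norm[OF newton])
  qed
qed

end
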